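(* Let $F = \{2^{n+2} - 1 : n \geq 0\} = \{3,7,15,31,\ldots\}$ and define $A = \mathbb{N} \setminus F$. Then the sequence $(r(3,A,n))_{n \geq 0}$ is strictly increasing from the start (that is, $r(3,A,n) > r(3,A,n-1)$ for all $n \geq 0$, with the convention $r(3,A,-1) = 0$), and the difference $d(n) = r(3,A,n) - r(3,A,n-1)$ can be calculated in time polynomial in $\log_2 n$ using the formula $$d(n) = n + 1 - 3 \lfloor \log_2(n+1) \rfloor + e(n) \qquad (n \geq 0),$$ where $e(n)$ is the sequence computed by the explicit 28-state automaton with output specified in the context.
   Context: $\mathbb{N} = \{0,1,2,\ldots\}$. For $A \subseteq \mathbb{N}$, $r(3,A,n)$ denotes the number of ordered triples $(a,b,c) \in A^3$ with $a+b+c = n$; by convention $r(3,A,-1) = 0$. The sequence $e(n)$ is defined by a deterministic finite automaton with output (DFAO) with states $0,1,\ldots,27$, initial state $0$, input alphabet $\{0,1\}$, transition function $\delta$ and output function $\tau$. The automaton reads the base-2 representation of $n$, most significant digit first (leading zeros do not matter since $\delta(0,0)=0$; $n=0$ ends in state $0$), and $e(n) = \tau(q)$, where $q$ is the state reached after reading all of the input. The automaton is given by the following list, where each entry has the form $q : (\delta(q,0), \delta(q,1), \tau(q))$: $0:(0,1,0)$; $1:(2,3,3)$; $2:(4,5,3)$; $3:(6,7,3)$; $4:(8,9,3)$; $5:(10,11,3)$; $6:(12,13,6)$; $7:(14,7,3)$; $8:(8,15,3)$; $9:(16,17,2)$; $10:(12,18,10)$; $11:(19,11,3)$; $12:(12,20,3)$;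 $13:(21,22,0)$; $14:(23,24,9)$; $15:(16,17,0)$; $16:(12,20,12)$; $17:(25,17,3)$; $18:(21,22,-1)$; $19:(23,26,13)$; $20:(21,22,-3)$; $21:(23,27,9)$; $22:(21,22,3)$; $23:(23,23,3)$; $24:(23,23,0)$; $25:(23,27,15)$; $26:(23,23,-1)$; $27:(23,23,-3)$. *)

theory Defs
  imports Complex_Main "HOL-Computational_Algebra.Polynomial"
begin

section \<open>Representations as a sum of three elements\<close>

text \<open>The last argument is an integer, so that \<open>r3 A (-1) = 0\<close> holds by definition.\<close>

definition r3 :: "nat set \<Rightarrow> int \<Rightarrow> nat" where
  "r3 A n = card {(a, b, c). a \<in> A \<and> b \<in> A \<and> c \<in> A \<and> int (a + b + c) = n}"

definition F :: "nat set" where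
  "F = {2 ^ (n + 2) - 1 | n. True}"

definition A :: "nat set" where
  "A = UNIV - F"

definition d :: "nat \<Rightarrow> int" where
  "d n = int (r3 A (int n)) - int (r3 A (int n - 1))"


section \<open>The automaton\<close>

text \<open>Base-2 digits, most significant digit first, without leading zeros; \<open>0\<close> is represented
  by the empty word.\<close>

fun bin :: "nat \<Rightarrow> nat list" where
  "bin n = (if n = 0 then [] else bin (n div 2) @ [n mod 2])"

declare bin.simps [simp del]

text \<open>Entry \<open>q\<close> lists the successor on digit 0, the successor on digit 1, and the output
  of state \<open>q\<close>.\<close>

definition dfao :: "(nat \<times> nat \<times> int) list" where
  "dfao =
   [(0, 1, 0),
    (2, 3, 3),
    (4, 5, 3),
    (6, 7, 3),
    (8, 9, 3),
    (10, 11, 3),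
    (12, 13, 6),
    (14, 7, 3),
    (8, 15, 3),
    (16, 17, 2),
    (12, 18, 10),
    (19, 11, 3),
    (12, 20, 3),
    (21, 22, 0),
    (23, 24, 9),
    (16, 17, 0),
    (12, 20, 12),
    (25, 17, 3),
    (21, 22, -1),
    (23, 26, 13),
    (21, 22, -3),
    (23, 27, 9),
    (21, 22, 3),
    (23, 23, 3),
    (23, 23, 0),
    (23, 27, 15),
    (23, 23, -1),
    (23, 23, -3)]"

definition \<delta> :: "nat \<Rightarrow> nat \<Rightarrow> nat" where
  "\<delta> q b = (case dfao ! q of (q0, q1, _) \<Rightarrow> if b = 0 then q0 else q1)"

definition \<tau> :: "nat \<Rightarrow> int" where
  "\<tau> q = (case dfao ! q of (_, _, out) \<Rightarrow> out)"

definition e :: "nat \<Rightarrow> int" where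
  "e n = \<tau> (foldl \<delta> 0 (bin n))"


section \<open>Polynomial-time computability\<close>

text \<open>Deterministic multi-tape Turing machines. States and tape symbols are initial segments of
  the natural numbers. The symbol 0 is the blank, and the binary digit \<open>b\<close> is represented by the
  symbol \<open>b + 1\<close>.\<close>

datatype move = Move_Left | Stay | Move_Right

fun offset :: "move \<Rightarrow> int" where
  "offset Move_Left = -1"
| "offset Stay = 0"
| "offset Move_Right = 1"

text \<open>A tape is infinite in both directions and comes with the position of its head.\<close>

type_synonym tape = "(int \<Rightarrow> nat) \<times> int"

record tm =
  num_tapes :: nat
  num_states :: nat
  num_symbols :: nat
  start :: nat
  halt :: nat
  trans :: "nat \<Rightarrow> nat list \<Rightarrow> nat \<times> (nat \<times> move) list"

text \<open>The bounds make the relevant part of the transition function a finite table.\<close>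

definition wf_tm :: "tm \<Rightarrow> bool" where
  "wf_tm M \<longleftrightarrow>
     num_tapes M \<ge> 1 \<and> num_symbols M \<ge> 3 \<and> start M < num_states M \<and> halt M < num_states M \<and>
     (\<forall>q syms q' acts.
        q < num_states M \<longrightarrow> length syms = num_tapes M \<longrightarrow> set syms \<subseteq> {..<num_symbols M} \<longrightarrow>
        trans M q syms = (q', acts) \<longrightarrow>
        q' < num_states M \<and> length acts = num_tapes M \<and> fst ` set acts \<subseteq> {..<num_symbols M})"

fun read :: "tape \<Rightarrow> nat" where
  "read (t, h) = t h"

fun act :: "nat \<times> move \<Rightarrow> tape \<Rightarrow> tape" where
  "act (s, m) (t, h) = (t(h := s), h + offset m)"

fun step :: "tm \<Rightarrow> nat \<times> tape list \<Rightarrow> nat \<times> tape list" where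
  "step M (q, tps) =
     (if q = halt M then (q, tps)
      else let (q', acts) = trans M q (map read tps) in (q', map2 act acts tps))"

definition word_tape :: "nat list \<Rightarrow> tape" where
  "word_tape w = (\<lambda>i. if 0 \<le> i \<and> i < int (length w) then w ! nat i + 1 else 0, 0)"

definition init_config :: "tm \<Rightarrow> nat \<Rightarrow> nat \<times> tape list" where
  "init_config M n = (start M, word_tape (bin n) # replicate (num_tapes M - 1) (word_tape []))"

text \<open>The word on a tape extends from the head to the right, up to the first blank.\<close>

fun has_word :: "tape \<Rightarrow> nat list \<Rightarrow> bool" where
  "has_word (t, h) w \<longleftrightarrow>
     (\<forall>i < length w. t (h + int i) = w ! i + 1) \<and> t (h + int (length w)) = 0"

text \<open>The input is given on the first tape, and the output is found on the last one.\<close>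

definition outputs_within :: "tm \<Rightarrow> nat \<Rightarrow> nat \<Rightarrow> nat \<Rightarrow> bool" where
  "outputs_within M n m t \<longleftrightarrow>
     (\<exists>tps. (step M ^^ t) (init_config M n) = (halt M, tps) \<and> has_word (last tps) (bin m))"

text \<open>The time bound is only required for \<open>n \<ge> 1\<close>, where \<open>log 2 n\<close> is meaningful; the machine
  has to be correct for \<open>n = 0\<close> too.\<close>

definition computable_in_poly_log_time :: "(nat \<Rightarrow> nat) \<Rightarrow> bool" where
  "computable_in_poly_log_time f \<longleftrightarrow>
     (\<exists>M (p :: real poly). wf_tm M \<and>
        (\<forall>n. \<exists>t. outputs_within M n (f n) t \<and> (n \<ge> 1 \<longrightarrow> real t \<le> poly p (log 2 (real n)))))"

end

theory Submission
  imports Defs "HOL-Computational_Algebra.Formal_Power_Series"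
begin

text \<open>Let \<open>G = 1 / (1 - X)\<close>, and let \<open>f\<close> be the generating function of \<open>F\<close>. The differences \<open>d n\<close> are
  the coefficients of \<open>(1 - X) (G - f)^3 = G^2 - 3 f G + 3 f^2 - (1 - X) f^3\<close>, and the first two
  terms give \<open>n + 1\<close> and the logarithm. Since \<open>X f = P(X^4)\<close> for \<open>P = \<Sum>i. X^(2^i)\<close>, the remaining terms
  are coefficients of \<open>P^2\<close> and \<open>P^3\<close>. From \<open>P = X + P(X^2)\<close> one gets recurrences along the binary
  digits for them, which the automaton tracks.

  With \<open>l\<close> binary digits, \<open>d n = n + c - 3 l\<close>, where \<open>c = 1 + e n\<close> if all digits are 1 and
  \<open>c = 4 + e n\<close> otherwise. So a machine with two tapes can copy \<open>n\<close> while it simulates the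
  automaton, add the bounded constant \<open>c\<close>, and then subtract 3 once for each digit of the input.\<close>

section \<open>The difference formula\<close>

unbundle fps_syntax

section \<open>Generating functions of sets and the shape of \<open>d\<close>\<close>

definition set_fps :: "nat set \<Rightarrow> int fps" where
  "set_fps S = Abs_fps (\<lambda>n. of_bool (n \<in> S))"

lemma set_fps_nth [simp]: "set_fps S $ n = of_bool (n \<in> S)"
  by (simp add: set_fps_def)

text \<open>A triple with sum \<open>n\<close> is fixed by its first two entries, so the count is a
  sum over pairs, which is the iterated Cauchy product.\<close>

lemma r3_eq_nth: "int (r3 S (int n)) = (set_fps S ^ 3) $ n"
proof -
  let ?T = "SIGMA a : {..n::nat}. {..n - a}"
  let ?P = "\<lambda>p. fst p \<in> S \<and> snd p \<in> S \<and> n - fst p - snd p \<in> S"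
  let ?f = "\<lambda>p. (fst p, snd p, n - fst p - snd p)"
  have "{(a, b, c). a \<in> S \<and> b \<in> S \<and> c \<in> S \<and> int (a + b + c) = int n} = ?f ` (?T \<inter> Collect ?P)"
  proof (intro equalityI subsetI)
    fix x assume "x \<in> {(a, b, c). a \<in> S \<and> b \<in> S \<and> c \<in> S \<and> int (a + b + c) = int n}"
    then obtain a b c where "x = (a, b, c)" "a \<in> S" "b \<in> S" "c \<in> S" "a + b + c = n"
      by (auto simp flip: of_nat_add)
    then show "x \<in> ?f ` (?T \<inter> Collect ?P)"
      by (intro rev_image_eqI[of "(a, b)"]) auto
  qed auto
  then have "r3 S (int n) = card (?f ` (?T \<inter> Collect ?P))"
    by (simp only: r3_def)
  also have "\<dots> = card (?T \<inter> Collect ?P)"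
    by (rule card_image) (auto simp: inj_on_def)
  also have "int \<dots> = (\<Sum>p\<in>?T. of_bool (?P p))"
    by (subst sum_of_bool_eq) (auto intro!: finite_SigmaI)
  also have "\<dots> = (\<Sum>(a, b)\<in>?T. of_bool (a \<in> S \<and> b \<in> S \<and> n - a - b \<in> S))"
    by (simp only: split_def)
  also have "\<dots> = (\<Sum>a\<le>n. \<Sum>b\<le>n - a. of_bool (a \<in> S \<and> b \<in> S \<and> n - a - b \<in> S))"
    by (rule sum.Sigma[symmetric]) auto
  also have "\<dots> = (set_fps S * (set_fps S * set_fps S)) $ n"
    by (simp only: of_bool_conj fps_mult_nth set_fps_nth sum_distrib_left atLeast0AtMost)
  finally show ?thesis
    by (simp only: power3_eq_cube mult.assoc)
qed

lemma r3_minus_one: "r3 S (-1) = 0"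
  by (auto simp: r3_def card_eq_0_iff)

lemma set_fps_UNIV_mult_nth: "(f * set_fps UNIV) $ n = (\<Sum>i\<le>n. f $ i)"
  by (simp add: fps_mult_nth atLeast0AtMost)

lemma one_minus_X_mult_set_fps_UNIV: "(1 - fps_X) * set_fps UNIV = 1"
  by (rule fps_ext) (simp add: left_diff_distrib)

text \<open>Multiplying by \<open>1 - fps_X\<close> takes differences of consecutive coefficients;
  the convention at -1 settles \<open>n = 0\<close>.\<close>

lemma d_eq_nth: "d n = ((1 - fps_X) * set_fps A ^ 3) $ n"
proof (cases n)
  case 0
  then show ?thesis using r3_eq_nth[of A 0]
    by (simp add: d_def r3_minus_one left_diff_distrib)
next
  case (Suc m)
  have "int (Suc m) - 1 = int m" by simp
  then show ?thesis using Suc r3_eq_nth[of A m] r3_eq_nth[of A n]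
    by (simp add: d_def left_diff_distrib)
qed

lemma d_eq_F:
  "d n = int n + 1 - 3 * int (card {f \<in> F. f \<le> n}) + 3 * (set_fps F ^ 2) $ n
     - ((1 - fps_X) * set_fps F ^ 3) $ n"
proof -
  let ?G = "set_fps UNIV" and ?F = "set_fps F"
  have A: "set_fps A = ?G - ?F" by (rule fps_ext) (simp add: A_def)
  \<comment> \<open>Every term of the expanded cube except the cube of \<open>?F\<close> has a
    factor \<open>?G\<close>, which absorbs \<open>1 - fps_X\<close>.\<close>
  have "(1 - fps_X) * set_fps A ^ 3 =
      ((1 - fps_X) * ?G) * (?G * ?G - 3 * (?F * ?G) + 3 * ?F ^ 2) - (1 - fps_X) * ?F ^ 3"
    unfolding A by (simp add: algebra_simps power2_eq_square power3_eq_cube)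
  also have "\<dots> = ?G * ?G - 3 * (?F * ?G) + 3 * ?F ^ 2 - (1 - fps_X) * ?F ^ 3"
    by (simp add: one_minus_X_mult_set_fps_UNIV)
  finally have "d n = (?G * ?G) $ n - 3 * (?F * ?G) $ n + 3 * (?F ^ 2) $ n - ((1 - fps_X) * ?F ^ 3) $ n"
    by (simp add: d_eq_nth numeral_fps_const)
  moreover have "(?F * ?G) $ n = int (card {f \<in> F. f \<le> n})"
    by (simp add: set_fps_UNIV_mult_nth sum.If_cases of_bool_def Int_def conj_commute)
  ultimately show ?thesis by (simp add: set_fps_UNIV_mult_nth)
qed

section \<open>The number of elements of \<open>F\<close> up to \<open>n\<close>\<close>

lemma floor_log2_eqI: "2 ^ L \<le> n \<Longrightarrow> n < 2 ^ (L + 1) \<Longrightarrow> \<lfloor>log 2 (real n)\<rfloor> = int L"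
  using floor_log_nat_eq_powr_iff[of 2 n L] by (cases "n = 0") auto

lemma floor_log2E:
  assumes "n > 0"
  obtains L where "\<lfloor>log 2 (real n)\<rfloor> = int L" "2 ^ L \<le> n" "n < 2 ^ (L + 1)"
proof -
  define L where "L = nat \<lfloor>log 2 (real n)\<rfloor>"
  have L: "\<lfloor>log 2 (real n)\<rfloor> = int L" using assms by (simp add: L_def)
  moreover from L have "2 ^ L \<le> n" "n < 2 ^ (L + 1)"
    using floor_log_nat_eq_powr_iff[of 2 n L] assms by auto
  ultimately show thesis by (rule that)
qed

text \<open>With \<open>L\<close> the floored logarithm, \<open>2 ^ (k + 2) - 1\<close> is at most
  \<open>n\<close> iff \<open>k + 2 \<le> L\<close>, which leaves \<open>L - 1\<close> values of
  \<open>k\<close>. For \<open>n = 0\<close> both \<open>L\<close> and the count are 0, hence the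
  correction.\<close>

lemma card_F_le: "int (card {f \<in> F. f \<le> n}) = \<lfloor>log 2 (real (n + 1))\<rfloor> - of_bool (n > 0)"
proof (cases "n = 0")
  case True
  have "{f \<in> F. f \<le> 0} = {}"
  proof -
    have "4 * 2 ^ k - 1 \<noteq> (0::nat)" for k
      using one_le_power[of "2::nat" k] by linarith
    then show ?thesis by (auto simp: F_def)
  qed
  then show ?thesis using True by simp
next
  case False
  obtain L where L: "\<lfloor>log 2 (real (n + 1))\<rfloor> = int L" and b: "2 ^ L \<le> n + 1" "n + 1 < 2 ^ (L + 1)"
    by (rule floor_log2E[of "n + 1"]) auto
  have L1: "L \<ge> 1"
    using b False by (cases L) auto
  have "{f \<in> F. f \<le> n} = (\<lambda>k. 2 ^ (k + 2) - 1) ` {..<L - 1}"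
  proof -
    have "2 ^ (k + 2) - 1 \<le> n \<longleftrightarrow> k < L - 1" for k
    proof -
      have "2 ^ (k + 2) - 1 \<le> n \<longleftrightarrow> (2::nat) ^ (k + 2) \<le> n + 1" by simp arith
      also have "\<dots> \<longleftrightarrow> k + 2 < L + 1"
      proof
        assume "2 ^ (k + 2) \<le> n + 1"
        with b have "(2::nat) ^ (k + 2) < 2 ^ (L + 1)" by linarith
        then show "k + 2 < L + 1" by (rule power_less_imp_less_exp[rotated]) simp
      next
        assume "k + 2 < L + 1"
        then have "(2::nat) ^ (k + 2) \<le> 2 ^ L" by (intro power_increasing) auto
        with b show "2 ^ (k + 2) \<le> n + 1" by linarith
      qed
      finally show ?thesis by auto
    qed
    then show ?thesis by (auto simp: F_def image_iff)
  qed
  moreover have "inj_on (\<lambda>k. 2 ^ (k + 2) - 1 :: nat) {..<L - 1}"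
  proof (rule inj_onI)
    fix i j :: nat assume "2 ^ (i + 2) - 1 = (2 ^ (j + 2) - 1 :: nat)"
    then have "(2::nat) ^ (i + 2) = 2 ^ (j + 2)" by (metis diff_add_inverse2 le_add_diff_inverse2 one_le_numeral one_le_power)
    then show "i = j" by simp
  qed
  ultimately have "card {f \<in> F. f \<le> n} = L - 1" by (simp add: card_image)
  then show ?thesis using L L1 False by simp
qed

section \<open>The series P of powers of two, and the coefficients of its square and cube\<close>

definition pow2_fps :: "int fps" where
  "pow2_fps = set_fps (range (\<lambda>i. 2 ^ i))"

lemma fps_nth_compose_X_power:
  fixes f :: "int fps"
  assumes "k > 0"
  shows "(f oo fps_X ^ k) $ n = (if k dvd n then f $ (n div k) else 0)"
proof -
  have "(f oo fps_X ^ k) $ n = (\<Sum>i\<in>{0..n}. f $ i * of_bool (n = k * i))"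
    unfolding fps_compose_nth by (simp add: fps_X_power_nth of_bool_def flip: power_mult)
  also have "\<dots> = (\<Sum>i\<in>{0..n} \<inter> {i. n = k * i}. f $ i)"
    by (simp add: of_bool_def if_distrib sum.If_cases cong: if_cong)
  also have "{0..n} \<inter> {i. n = k * i} = (if k dvd n then {n div k} else {})"
    using assms by (auto elim!: dvdE)
  finally show ?thesis by simp
qed

lemma pow2_fps_nth: "pow2_fps $ n = of_bool (\<exists>i. n = 2 ^ i)"
  by (auto simp: pow2_fps_def)

text \<open>Split off the exponent 1; the remaining powers of two are the doubles of all powers of
  two.\<close>

lemma pow2_fps_eq: "pow2_fps = fps_X + (pow2_fps oo fps_X ^ 2)"
proof (rule fps_ext)
  fix n :: nat
  have "(\<exists>i. n = 2 ^ i) \<longleftrightarrow> n = 1 \<or> even n \<and> (\<exists>i. n div 2 = 2 ^ i)"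
  proof
    assume "\<exists>i. n = 2 ^ i"
    then obtain i where "n = 2 ^ i" ..
    then show "n = 1 \<or> even n \<and> (\<exists>i. n div 2 = 2 ^ i)" by (cases i) auto
  next
    assume "n = 1 \<or> even n \<and> (\<exists>i. n div 2 = 2 ^ i)"
    then show "\<exists>i. n = 2 ^ i"
    proof
      assume "even n \<and> (\<exists>i. n div 2 = 2 ^ i)"
      then obtain i where "n = 2 ^ Suc i" by auto
      then show ?thesis by blast
    qed (auto intro: exI[of _ 0])
  qed
  then show "pow2_fps $ n = (fps_X + (pow2_fps oo fps_X ^ 2)) $ n"
    by (cases "n = 1") (simp_all add: fps_nth_compose_X_power pow2_fps_nth)
qed

lemma pow2_fps_square_eq:
  "pow2_fps ^ 2 = fps_X ^ 2 + 2 * (fps_X * (pow2_fps oo fps_X ^ 2)) + (pow2_fps ^ 2 oo fps_X ^ 2)"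
proof -
  have "pow2_fps ^ 2 = (fps_X + (pow2_fps oo fps_X ^ 2)) ^ 2"
    by (rule arg_cong[OF pow2_fps_eq])
  then show ?thesis
    by (simp add: power2_sum fps_compose_power mult.assoc add_ac)
qed

lemma pow2_fps_cube_eq:
  "pow2_fps ^ 3 = fps_X ^ 3 + 3 * (fps_X ^ 2 * (pow2_fps oo fps_X ^ 2))
     + 3 * (fps_X * (pow2_fps ^ 2 oo fps_X ^ 2)) + (pow2_fps ^ 3 oo fps_X ^ 2)"
proof -
  have "(a + b) ^ 3 = a ^ 3 + 3 * (a ^ 2 * b) + 3 * (a * b ^ 2) + b ^ 3" for a b :: "int fps"
    by (simp add: algebra_simps power2_eq_square power3_eq_cube)
  moreover have "pow2_fps ^ 3 = (fps_X + (pow2_fps oo fps_X ^ 2)) ^ 3"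
    by (rule arg_cong[OF pow2_fps_eq])
  ultimately show ?thesis
    by (simp add: fps_compose_power)
qed

lemma fps_numeral_mult_nth: "(numeral k * f) $ n = numeral k * (f $ n :: int)"
  by (simp add: numeral_fps_const)

lemmas pow2_fps_nth_simps = fps_numeral_mult_nth fps_X_power_mult_nth fps_nth_compose_X_power

lemma pow2_fps_0 [simp]: "pow2_fps $ 0 = 0"
  by (simp add: pow2_fps_nth)

lemma pow2_fps_double:
  "pow2_fps $ (2 * m) = pow2_fps $ m"
  "pow2_fps $ (2 * m + 1) = of_bool (m = 0)"
  using arg_cong[OF pow2_fps_eq, of "\<lambda>f. f $ (2 * m)"] arg_cong[OF pow2_fps_eq, of "\<lambda>f. f $ (2 * m + 1)"]
  by (simp_all add: pow2_fps_nth_simps)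

lemma pow2_fps_square_double:
  "pow2_fps ^ 2 $ (2 * m) = of_bool (m = 1) + pow2_fps ^ 2 $ m"
  "pow2_fps ^ 2 $ (2 * m + 1) = 2 * pow2_fps $ m"
  using arg_cong[OF pow2_fps_square_eq, of "\<lambda>f. f $ (2 * m)"]
    arg_cong[OF pow2_fps_square_eq, of "\<lambda>f. f $ (2 * m + 1)"]
  by (auto simp add: pow2_fps_nth_simps)

text \<open>Parity separates the four terms of the expanded cube. The term \<open>X^2 P(X^2)\<close>
  contributes at \<open>2 * (m + 1)\<close> the coefficient of P at \<open>m\<close>, hence the
  shifted index in the even case.\<close>

lemma pow2_fps_cube_double:
  "pow2_fps ^ 3 $ (2 * (m + 1)) = 3 * pow2_fps $ m + pow2_fps ^ 3 $ (m + 1)"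
  "pow2_fps ^ 3 $ (2 * m + 1) = of_bool (m = 1) + 3 * pow2_fps ^ 2 $ m"
  using arg_cong[OF pow2_fps_cube_eq, of "\<lambda>f. f $ (2 * (m + 1))"]
    arg_cong[OF pow2_fps_cube_eq, of "\<lambda>f. f $ (2 * m + 1)"]
  by (auto simp add: pow2_fps_nth_simps)

section \<open>The automaton tracks the coefficients\<close>

definition reach :: "nat \<Rightarrow> nat" where
  "reach n = foldl \<delta> 0 (bin n)"

text \<open>The digit read last is \<open>n mod 2\<close>. The rule covers \<open>n = 0\<close> too
  because state 0 loops on digit 0.\<close>

lemma reach_rec: "reach n = \<delta> (reach (n div 2)) (n mod 2)"
proof (cases "n = 0")
  case True
  then show ?thesis by (simp add: reach_def bin.simps[of 0] \<delta>_def dfao_def)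
next
  case False
  then show ?thesis by (simp add: reach_def bin.simps[of n])
qed

text \<open>The output on \<open>4 * m + b\<close> for \<open>b < 4\<close> depends only on \<open>b\<close>, on whether \<open>m = 0\<close>, and on the last
  two components of the tuple for \<open>m\<close>; the others make the tuple computable digit by digit.
  The list \<open>profiles\<close> is indexed by the states: each state of the automaton determines the tuple.\<close>

definition profile :: "nat \<Rightarrow> bool \<times> bool \<times> int \<times> int \<times> int \<times> int \<times> int" where
  "profile n = (n = 0, n = 1, pow2_fps $ n, pow2_fps ^ 2 $ n,
     pow2_fps $ (n + 1), pow2_fps ^ 2 $ (n + 1), pow2_fps ^ 3 $ (n + 1))"

definition profiles :: "(bool \<times> bool \<times> int \<times> int \<times> int \<times> int \<times> int) list" where
  "profiles =
   [(True, False, 0, 0, 1, 0, 0),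
    (False, True, 1, 0, 1, 1, 0),
    (False, False, 1, 1, 0, 2, 1),
    (False, False, 0, 2, 1, 1, 3),
    (False, False, 1, 1, 0, 2, 3),
    (False, False, 0, 2, 0, 2, 4),
    (False, False, 0, 2, 0, 0, 6),
    (False, False, 0, 0, 1, 1, 3),
    (False, False, 1, 1, 0, 2, 3),
    (False, False, 0, 2, 0, 2, 6),
    (False, False, 0, 2, 0, 0, 6),
    (False, False, 0, 0, 0, 2, 4),
    (False, False, 0, 2, 0, 0, 6),
    (False, False, 0, 0, 0, 0, 6),
    (False, False, 0, 0, 0, 0, 0),
    (False, False, 0, 2, 0, 2, 6),
    (False, False, 0, 2, 0, 0, 6),
    (False, False, 0, 0, 0, 2, 6),
    (False, False, 0, 0, 0, 0, 6),
    (False, False, 0, 0, 0, 0, 0),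
    (False, False, 0, 0, 0, 0, 6),
    (False, False, 0, 0, 0, 0, 0),
    (False, False, 0, 0, 0, 0, 6),
    (False, False, 0, 0, 0, 0, 0),
    (False, False, 0, 0, 0, 0, 0),
    (False, False, 0, 0, 0, 0, 0),
    (False, False, 0, 0, 0, 0, 0),
    (False, False, 0, 0, 0, 0, 0)]"

text \<open>The effect on \<open>profile m\<close> of appending the digit \<open>b\<close>, by the
  doubling rules: \<open>p\<close>, \<open>q\<close> are the coefficients of P, P^2 at
  \<open>m\<close>, and \<open>p'\<close>, \<open>q'\<close>, \<open>r'\<close> those of P, P^2, P^3
  at \<open>m + 1\<close>.\<close>

fun profile_step :: "nat \<Rightarrow> bool \<times> bool \<times> int \<times> int \<times> int \<times> int \<times> int
    \<Rightarrow> bool \<times> bool \<times> int \<times> int \<times> int \<times> int \<times> int" where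
  "profile_step b (z, u, p, q, p', q', r') =
     (if b = 0 then (z, False, p, of_bool u + q, of_bool z, 2 * p, of_bool u + 3 * q)
      else (False, z, of_bool z, 2 * p, p', of_bool z + q', 3 * p + r'))"

lemma profile_rec: "profile n = profile_step (n mod 2) (profile (n div 2))"
proof -
  define m where "m = n div 2"
  have *: "2 * m + 1 + 1 = 2 * (m + 1)" by simp
  consider "n = 2 * m" "n mod 2 = 0" | "n = 2 * m + 1" "n mod 2 = 1"
    unfolding m_def by (cases "even n") (auto elim!: evenE oddE)
  then have "profile n = profile_step (n mod 2) (profile m)"
  proof cases
    case 1
    then show ?thesis
      unfolding profile_def 1(1) pow2_fps_double pow2_fps_square_double pow2_fps_cube_double
      by simp
  next
    case 2
    then show ?thesis
      unfolding profile_def 2(1) * pow2_fps_double pow2_fps_square_double pow2_fps_cube_double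
      by auto
  qed
  then show ?thesis by (simp only: m_def)
qed

lemma All_less_28: "(\<forall>q < 28. P q) \<longleftrightarrow> P 0 \<and> P 1 \<and> P 2 \<and> P 3 \<and> P 4 \<and> P 5 \<and> P 6 \<and>
    P 7 \<and> P 8 \<and> P 9 \<and> P 10 \<and> P 11 \<and> P 12 \<and> P 13 \<and>
    P 14 \<and> P 15 \<and> P 16 \<and> P 17 \<and> P 18 \<and> P 19 \<and> P 20 \<and>
    P 21 \<and> P 22 \<and> P 23 \<and> P 24 \<and> P 25 \<and> P 26 \<and> P 27" for P :: "nat \<Rightarrow> bool"
  by (simp add: numeral_eq_Suc All_less_Suc conj_ac)

text \<open>A finite check over the states. Any \<open>b\<close> is allowed because both functions
  only test whether \<open>b = 0\<close>.\<close>

lemma profile_step_profiles: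
  assumes "q < 28"
  shows "\<delta> q b < 28" "profile_step b (profiles ! q) = profiles ! \<delta> q b"
proof -
  have "\<forall>q < 28. \<delta> q b < 28 \<and> profile_step b (profiles ! q) = profiles ! \<delta> q b"
    by (cases "b = 0") (simp_all only: All_less_28, simp_all add: \<delta>_def profiles_def dfao_def)
  then show "\<delta> q b < 28" "profile_step b (profiles ! q) = profiles ! \<delta> q b"
    using assms by auto
qed

text \<open>Induction along \<open>n div 2\<close>: appending a digit advances the state and the
  tuple in parallel.\<close>

lemma profile_eq: "reach n < 28 \<and> profile n = profiles ! reach n"
proof (induction n rule: less_induct)
  case (less n)
  show ?case
  proof (cases "n = 0")
    case True
    moreover have "pow2_fps $ 1 = 1"
      using pow2_fps_double(2)[of 0] by simp
    moreover have "pow2_fps ^ 2 $ 1 = 0" "pow2_fps ^ 3 $ 1 = 0"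
      using pow2_fps_square_double(2)[of 0] pow2_fps_cube_double(2)[of 0]
      by (simp_all add: power2_eq_square)
    ultimately show ?thesis
      by (simp add: reach_def bin.simps[of 0] profile_def profiles_def power2_eq_square)
  next
    case False
    then have "reach (n div 2) < 28 \<and> profile (n div 2) = profiles ! reach (n div 2)"
      using less.IH by simp
    then show ?thesis
      using profile_step_profiles by (simp add: reach_rec[of n] profile_rec[of n])
  qed
qed

lemma output_profiles:
  assumes "s < 28" "profiles ! s = (z, u, p, q, p', q', r')"
  shows "\<tau> (\<delta> (\<delta> s 0) 0) = (if z then 0 else 3)" "\<tau> (\<delta> (\<delta> s 0) 1) = 3 - r'"
    "\<tau> (\<delta> (\<delta> s 1) 0) = 3 + 3 * q' + r'" "\<tau> (\<delta> (\<delta> s 1) 1) = 3"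
proof -
  have "\<forall>s < 28. case profiles ! s of (z, u, p, q, p', q', r') \<Rightarrow>
      \<tau> (\<delta> (\<delta> s 0) 0) = (if z then 0 else 3) \<and> \<tau> (\<delta> (\<delta> s 0) 1) = 3 - r' \<and>
      \<tau> (\<delta> (\<delta> s 1) 0) = 3 + 3 * q' + r' \<and> \<tau> (\<delta> (\<delta> s 1) 1) = 3"
    unfolding All_less_28 by (simp add: \<delta>_def \<tau>_def profiles_def dfao_def)
  then show "\<tau> (\<delta> (\<delta> s 0) 0) = (if z then 0 else 3)" "\<tau> (\<delta> (\<delta> s 0) 1) = 3 - r'"
    "\<tau> (\<delta> (\<delta> s 1) 0) = 3 + 3 * q' + r'" "\<tau> (\<delta> (\<delta> s 1) 1) = 3"
    using assms by auto
qed

lemma e_eq_reach: "e n = \<tau> (reach n)"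
  by (simp add: e_def reach_def)

lemma e_mod_4:
  "e (4 * m) = (if m = 0 then 0 else 3)" (is ?t0)
  "e (4 * m + 1) = 3 - pow2_fps ^ 3 $ (m + 1)" (is ?t1)
  "e (4 * m + 2) = 3 + 3 * pow2_fps ^ 2 $ (m + 1) + pow2_fps ^ 3 $ (m + 1)" (is ?t2)
  "e (4 * m + 3) = 3" (is ?t3)
proof -
  \<comment> \<open>The last two digits act on the state reached by \<open>n div 4\<close>.\<close>
  have *: "e n = \<tau> (\<delta> (\<delta> (reach (n div 4)) (n div 2 mod 2)) (n mod 2))" for n
    by (simp add: e_eq_reach reach_rec[of n] reach_rec[of "n div 2"] div_mult2_eq[symmetric])
  have "profiles ! reach m = (m = 0, m = 1, pow2_fps $ m, pow2_fps ^ 2 $ m,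
     pow2_fps $ (m + 1), pow2_fps ^ 2 $ (m + 1), pow2_fps ^ 3 $ (m + 1))"
    using profile_eq[of m] by (simp add: profile_def)
  note out = output_profiles[OF _ this]
  have "4 * m div 4 = m" "4 * m div 2 mod 2 = 0" "4 * m mod 2 = 0" by presburger+
  then show ?t0 using out(1) profile_eq[of m] by (simp only: *)
  have "(4 * m + 1) div 4 = m" "(4 * m + 1) div 2 mod 2 = 0" "(4 * m + 1) mod 2 = 1" by presburger+
  then show ?t1 using out(2) profile_eq[of m] by (simp only: *)
  have "(4 * m + 2) div 4 = m" "(4 * m + 2) div 2 mod 2 = 1" "(4 * m + 2) mod 2 = 0" by presburger+
  then show ?t2 using out(3) profile_eq[of m] by (simp only: *)
  have "(4 * m + 3) div 4 = m" "(4 * m + 3) div 2 mod 2 = 1" "(4 * m + 3) mod 2 = 1" by presburger+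
  then show ?t3 using out(4) profile_eq[of m] by (simp only: *)
qed

section \<open>Matching the automaton's output with the series of \<open>F\<close>\<close>

lemma X_mult_set_fps_F: "fps_X * set_fps F = pow2_fps oo fps_X ^ 4"
proof (rule fps_ext)
  fix n :: nat
  have "n \<noteq> 0 \<and> n - 1 \<in> F \<longleftrightarrow> 4 dvd n \<and> (\<exists>i. n div 4 = 2 ^ i)"
  proof
    assume "n \<noteq> 0 \<and> n - 1 \<in> F"
    then obtain k where "n - 1 = 2 ^ (k + 2) - 1" "n > 0" by (auto simp: F_def)
    moreover have "(2::nat) ^ (k + 2) \<ge> 1" by (rule one_le_power) simp
    ultimately have "n = 2 ^ (k + 2)" by linarith
    then have "n = 4 * 2 ^ k" by simp
    then show "4 dvd n \<and> (\<exists>i. n div 4 = 2 ^ i)" by auto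
  next
    assume "4 dvd n \<and> (\<exists>i. n div 4 = 2 ^ i)"
    then obtain k where "n = 4 * 2 ^ k" by auto
    then have "n = 2 ^ (k + 2)" by simp
    then show "n \<noteq> 0 \<and> n - 1 \<in> F" by (auto simp: F_def)
  qed
  then show "(fps_X * set_fps F) $ n = (pow2_fps oo fps_X ^ 4) $ n"
    by (auto simp: fps_nth_compose_X_power pow2_fps_nth)
qed

text \<open>Giving each of the \<open>k\<close> factors one \<open>fps_X\<close> turns all exponents
  into multiples of 4, at the price of shifting the index by \<open>k\<close>.\<close>

lemma set_fps_F_power_nth:
  "(set_fps F ^ k) $ n = (if 4 dvd n + k then pow2_fps ^ k $ ((n + k) div 4) else 0)"
proof -
  have "(set_fps F ^ k) $ n = (fps_X ^ k * set_fps F ^ k) $ (n + k)"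
    by (simp add: fps_X_power_mult_nth)
  also have "\<dots> = (pow2_fps ^ k oo fps_X ^ 4) $ (n + k)"
    by (simp add: fps_compose_power X_mult_set_fps_F flip: power_mult_distrib)
  finally show ?thesis by (simp add: fps_nth_compose_X_power)
qed

text \<open>The subtracted term is the coefficient at \<open>n - 1\<close>, with shifted index
  \<open>n + 2\<close>. At \<open>n = 0\<close> it vanishes as it should, since 4 does not divide
  2.\<close>

lemma one_minus_X_F_cube_nth:
  "((1 - fps_X) * set_fps F ^ 3) $ n =
     (if 4 dvd n + 3 then pow2_fps ^ 3 $ ((n + 3) div 4) else 0) -
     (if 4 dvd n + 2 then pow2_fps ^ 3 $ ((n + 2) div 4) else 0)"
proof (cases n)
  case (Suc m)
  have "Suc m + 2 = m + 3" by simp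
  then show ?thesis
    unfolding Suc by (simp only: left_diff_distrib fps_sub_nth set_fps_F_power_nth) (simp add: set_fps_F_power_nth)
qed (simp add: left_diff_distrib set_fps_F_power_nth)

text \<open>The square contributes only for \<open>n\<close> congruent to 2 modulo 4, the cube only
  for 1, and the cube times \<open>fps_X\<close> only for 2. These are the four cases of
  \<open>e_mod_4\<close>.\<close>

lemma e_eq:
  "e n = 3 * of_bool (n > 0) + 3 * (set_fps F ^ 2) $ n - ((1 - fps_X) * set_fps F ^ 3) $ n"
proof -
  define m where "m = n div 4"
  have "n = 4 * m \<or> n = 4 * m + 1 \<or> n = 4 * m + 2 \<or> n = 4 * m + 3"
    unfolding m_def by presburger
  then consider "n = 4 * m" | "n = 4 * m + 1" | "n = 4 * m + 2" | "n = 4 * m + 3" by blast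
  then show ?thesis
  proof cases
    case 1
    moreover have "\<not> 4 dvd 4 * m + 2" "\<not> 4 dvd 4 * m + 3" by presburger+
    ultimately show ?thesis
      by (simp only: one_minus_X_F_cube_nth set_fps_F_power_nth e_mod_4) simp
  next
    case 2
    moreover have "\<not> 4 dvd 4 * m + 1 + 2" "4 dvd 4 * m + 1 + 3" "(4 * m + 1 + 3) div 4 = m + 1"
      by presburger+
    ultimately show ?thesis
      by (simp only: one_minus_X_F_cube_nth set_fps_F_power_nth e_mod_4) simp
  next
    case 3
    moreover have "4 dvd 4 * m + 2 + 2" "\<not> 4 dvd 4 * m + 2 + 3" "(4 * m + 2 + 2) div 4 = m + 1"
      by presburger+
    ultimately show ?thesis
      by (simp only: one_minus_X_F_cube_nth set_fps_F_power_nth e_mod_4) simp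
  next
    case 4
    moreover have "\<not> 4 dvd 4 * m + 3 + 2" "\<not> 4 dvd 4 * m + 3 + 3" by presburger+
    ultimately show ?thesis
      by (simp only: one_minus_X_F_cube_nth set_fps_F_power_nth e_mod_4) simp
  qed
qed

text \<open>The term \<open>3 * of_bool (n > 0)\<close> in \<open>e\<close> compensates for the
  correction in \<open>card_F_le\<close>.\<close>

lemma d_formula: "d n = int n + 1 - 3 * \<lfloor>log 2 (real (n + 1))\<rfloor> + e n"
  unfolding d_eq_F card_F_le e_eq by simp

lemma \<tau>_bounds: "q < 28 \<Longrightarrow> -3 \<le> \<tau> q \<and> \<tau> q \<le> 15"
proof -
  have "\<forall>q < 28. -3 \<le> \<tau> q \<and> \<tau> q \<le> 15"
    unfolding All_less_28 by (simp add: \<tau>_def dfao_def)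
  then show "q < 28 \<Longrightarrow> -3 \<le> \<tau> q \<and> \<tau> q \<le> 15" by blast
qed

text \<open>For \<open>L \<ge> 4\<close> the bound \<open>3 * L + 3 < 2 ^ L\<close> outweighs the
  worst output -3; below that only \<open>n < 15\<close> remains.\<close>

lemma d_pos: "d n > 0"
proof -
  obtain L where L: "\<lfloor>log 2 (real (n + 1))\<rfloor> = int L" "2 ^ L \<le> n + 1" "n + 1 < 2 ^ (L + 1)"
    by (rule floor_log2E[of "n + 1"]) auto
  have dn: "d n = int n + 1 - 3 * int L + e n"
    using L(1) d_formula by simp
  show ?thesis
  proof (cases "L \<ge> 4")
    case True
    then have "3 * L + 3 < 2 ^ L" by (induction rule: dec_induct) auto
    moreover have "e n \<ge> -3" using \<tau>_bounds profile_eq by (simp add: e_eq_reach)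
    ultimately show ?thesis using L(2) dn by linarith
  next
    case False
    then have "(2::nat) ^ (L + 1) \<le> 2 ^ 4" by (intro power_increasing) auto
    with L(3) have n: "n < 15" by simp
    then have "n \<in> {0, 1, 2, 3, 4, 5, 6, 7, 8, 9, 10, 11, 12, 13, 14}" unfolding insert_iff empty_iff by arith
    \<comment> \<open>From 9 to 14, \<open>L = 3\<close> and \<open>n + 1 > 9\<close> suffice; from
      1 to 8 the output 3 covers the deficit, which is largest at \<open>n = 3\<close>.\<close>
    then have "e n \<ge> (if 1 \<le> n \<and> n \<le> 8 then 3 else 0)"
      unfolding e_def
      by (elim insertE emptyE; simp add: bin.simps \<delta>_def \<tau>_def dfao_def)
    moreover have "L = 0 \<or> L = 1 \<or> L = 2 \<or> L = 3" using False by auto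
    ultimately show ?thesis using L(2,3) dn by (auto split: if_splits)
  qed
qed


section \<open>The Turing machine\<close>

lemma bin_digits: "set (bin n) \<subseteq> {..<2}"
  by (induction n rule: bin.induct) (subst bin.simps, auto)

lemma length_bin_bounds:
  "n < 2 ^ length (bin n)" "n > 0 \<Longrightarrow> 2 ^ length (bin n) \<le> 2 * n"
proof (induction n rule: bin.induct)
  case (1 n)
  { case 1
    then show ?case using "1.IH"(1) by (subst bin.simps) auto
  next
    case 2
    show ?case
    proof (cases "n = 1")
      case True
      then show ?thesis by (simp add: bin.simps)
    next
      case False
      then have "2 ^ length (bin (n div 2)) \<le> 2 * (n div 2)" using "1.IH"(2) 2 by simp
      then show ?thesis using 2 by (subst bin.simps) auto
    qed }
qed

lemma zero_notin_bin_iff: "0 \<notin> set (bin n) \<longleftrightarrow> n + 1 = 2 ^ length (bin n)"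
proof (induction n rule: bin.induct)
  case (1 n)
  show ?case
  proof (cases "n = 0")
    case False
    then have "0 \<notin> set (bin n) \<longleftrightarrow> n mod 2 = 1 \<and> n div 2 + 1 = 2 ^ length (bin (n div 2))"
      using 1 by (subst bin.simps) auto
    also have "\<dots> \<longleftrightarrow> n + 1 = 2 * 2 ^ length (bin (n div 2))"
      by presburger
    finally show ?thesis using False by (subst (2) bin.simps) simp
  qed (simp add: bin.simps)
qed

text \<open>Adding 1 produces a further digit exactly when all digits of \<open>n\<close> are 1, and
  the floored logarithm is one less than the number of digits of \<open>n + 1\<close>.\<close>

lemma floor_log2_Suc:
  "\<lfloor>log 2 (real (n + 1))\<rfloor> = int (length (bin n)) - of_bool (0 \<in> set (bin n))"
proof (cases "0 \<in> set (bin n)")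
  case False
  then have "n + 1 = 2 ^ length (bin n)" using zero_notin_bin_iff by blast
  then have "\<lfloor>log 2 (real (n + 1))\<rfloor> = int (length (bin n))"
    by (intro floor_log2_eqI) simp_all
  then show ?thesis using False by simp
next
  case True
  then have "n + 1 \<noteq> 2 ^ length (bin n)" using zero_notin_bin_iff by blast
  then have b: "n + 1 < 2 ^ length (bin n)" using length_bin_bounds(1)[of n] by simp
  have "n > 0" using True by (cases "n = 0") (auto simp: bin.simps)
  then have b': "2 ^ length (bin n) \<le> 2 * n" by (rule length_bin_bounds)
  have l: "length (bin n) = Suc (length (bin n) - 1)" using True by (cases "bin n") auto
  then have "2 ^ length (bin n) = 2 * (2::nat) ^ (length (bin n) - 1)" by (metis power_Suc)
  then have "\<lfloor>log 2 (real (n + 1))\<rfloor> = int (length (bin n) - 1)"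
    using b b' by (intro floor_log2_eqI) simp_all
  then show ?thesis using True l by simp
qed

lemma length_bin_le_log:
  assumes "n \<ge> 1"
  shows "real (length (bin n)) \<le> log 2 (real n) + 1"
proof -
  have "2 ^ length (bin n) \<le> 2 * n" using assms by (intro length_bin_bounds) simp
  then have "(2::real) ^ length (bin n) \<le> 2 * real n" by (metis numeral_power_le_of_nat_cancel_iff of_nat_mult of_nat_numeral)
  then have "log 2 ((2::real) ^ length (bin n)) \<le> log 2 (2 * real n)" by (subst log_le_cancel_iff) (use assms in auto)
  then show ?thesis using assms by (simp add: log_mult)
qed

section \<open>Addition on digit lists\<close>

text \<open>Digit lists with the least significant digit first.\<close>

abbreviation val :: "nat list \<Rightarrow> int" where
  "val \<equiv> horner_sum int 2"

lemma val_rev_bin: "val (rev (bin n)) = int n"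
proof (induction n rule: bin.induct)
  case (1 n)
  moreover have "int (n mod 2) + 2 * int (n div 2) = int n" by presburger
  ultimately show ?case by (subst bin.simps) auto
qed

lemma val_nonneg: "val xs \<ge> 0"
  by (induction xs) auto

text \<open>The final 1 is the leading digit, so the reversed list has no leading zeros, as
  \<open>bin\<close> demands.\<close>

lemma bin_val:
  assumes "set ys \<subseteq> {..<2}"
  shows "bin (nat (val (ys @ [1]))) = rev (ys @ [1])"
  using assms
proof (induction ys)
  case Nil
  show ?case by (simp add: bin.simps)
next
  case (Cons y ys)
  have "val (ys @ [1]) > 0"
    by (simp add: horner_sum_append add_nonneg_pos val_nonneg)
  then obtain v where v: "val (ys @ [1]) = int v" "v > 0"
    by (rule zero_less_imp_eq_int[THEN exE]) auto
  have "nat (val ((y # ys) @ [1])) = y + 2 * v"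
    using v(1) by simp
  moreover have "bin (y + 2 * v) = bin v @ [y]"
    using Cons.prems v(2) by (subst bin.simps) auto
  ultimately show ?case using Cons v by simp
qed

lemma strip_leading_zeros:
  assumes "set xs \<subseteq> {..<2}" "val xs > 0"
  obtains ys k where "xs = ys @ [1] @ replicate k 0" "set ys \<subseteq> {..<2}" "val xs = val (ys @ [1])"
  using assms
proof (induction xs arbitrary: thesis rule: rev_induct)
  case (snoc x xs)
  show thesis
  proof (cases "x = 0")
    case True
    then have eq: "val (xs @ [x]) = val xs" by (simp add: horner_sum_append)
    obtain ys k where "xs = ys @ [1] @ replicate k 0" "set ys \<subseteq> {..<2}" "val xs = val (ys @ [1])"
      using snoc.IH snoc.prems eq by auto
    then show thesis using snoc.prems(1)[of ys "Suc k"] eq True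
      by (simp add: replicate_append_same)
  next
    case False
    then have "x = 1" using snoc.prems by auto
    then show thesis using snoc.prems by (intro snoc.prems(1)[of xs 0]) auto
  qed
qed simp

text \<open>Since \<open>div\<close> and \<open>mod\<close> round downwards, a negative
  \<open>c\<close> acts as a borrow, so one procedure both adds and subtracts. Past the last digit,
  zeros are assumed while a positive carry remains.\<close>

function add_carry :: "int \<Rightarrow> nat list \<Rightarrow> nat list" where
  "add_carry c [] = (if c \<le> 0 then [] else nat (c mod 2) # add_carry (c div 2) [])"
| "add_carry c (b # bs) = nat ((int b + c) mod 2) # add_carry ((int b + c) div 2) bs"
  by pat_completeness auto
termination
  by (relation "measures [\<lambda>(c, bs). length bs, \<lambda>(c, bs). nat c]") auto

declare add_carry.simps(1) [simp del]

text \<open>Each step splits \<open>int b + c\<close> into a digit plus twice the next carry. The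
  hypothesis rules out a negative carry at the end, which would be dropped.\<close>

lemma val_add_carry: "0 \<le> val bs + c \<Longrightarrow> val (add_carry c bs) = val bs + c"
proof (induction c bs rule: add_carry.induct)
  case (1 c)
  then show ?case by (subst add_carry.simps) (auto simp: pos_imp_zdiv_nonneg_iff)
next
  case (2 c b bs)
  have "0 \<le> val bs + (int b + c) div 2" using 2(2) by simp
  then show ?case using 2(1) by simp
qed

lemma add_carry_digits: "set (add_carry c bs) \<subseteq> {..<2}"
proof (induction c bs rule: add_carry.induct)
  case (1 c)
  then show ?case by (subst add_carry.simps) (auto simp: nat_less_iff)
qed (auto simp: nat_less_iff)

text \<open>Each digit past the end lowers the carry by at least one. For negative \<open>c\<close>
  the list never grows.\<close>

lemma length_add_carry: "set bs \<subseteq> {..<2} \<Longrightarrow> length (add_carry c bs) \<le> length bs + nat c"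
proof (induction c bs rule: add_carry.induct)
  case (1 c)
  then show ?case by (subst add_carry.simps) auto
next
  case (2 c b bs)
  have "nat ((int b + c) div 2) \<le> nat c" using 2(2) by auto
  then show ?case using 2 by simp
qed

section \<open>Runs, and the concrete machine\<close>

definition steps :: "tm \<Rightarrow> nat \<Rightarrow> nat \<times> tape list \<Rightarrow> nat \<times> tape list \<Rightarrow> bool" where
  "steps M t c c' \<longleftrightarrow> (step M ^^ t) c = c'"

lemma steps_0: "steps M 0 c c"
  by (simp add: steps_def)

lemma steps_step: "step M c = c' \<Longrightarrow> steps M (Suc 0) c c'"
  by (simp add: steps_def)

lemma steps_trans: "steps M s c c' \<Longrightarrow> steps M t c' c'' \<Longrightarrow> steps M (s + t) c c''"
  by (simp add: steps_def add.commute[of s] funpow_add)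

lemma steps_Suc: "step M c = c' \<Longrightarrow> steps M t c' c'' \<Longrightarrow> steps M (Suc t) c c''"
  by (auto simp: steps_def funpow_swap1)

text \<open>States: \<open>q + 28 z\<close> for \<open>q < 28\<close>, \<open>z < 2\<close> copies the input to the second tape while
  simulating the automaton, with \<open>z = 1\<close> after a digit 0; \<open>59 + c\<close> adds the carry \<open>c\<close> from right
  to left, where \<open>-3 \<le> c \<le> 20\<close>; 80 returns to the right end and then, for every digit of
  the input, subtracts 3; 81 and 82 find the leading digit; 83 halts.\<close>

definition table :: "nat \<Rightarrow> nat \<Rightarrow> nat \<Rightarrow> nat \<times> (nat \<times> move) list" where
  "table s a b =
     (if s < 56 then
        if a = 0 then (nat (60 + \<tau> (s mod 28) + 3 * int (s div 28)), [(a, Move_Left), (b, Move_Left)])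
        else (\<delta> (s mod 28) (a - 1) + 28 * of_bool (28 \<le> s \<or> a = 1), [(a, Move_Right), (a, Move_Right)])
      else if s < 80 then
        if b = 0 \<and> s \<le> 59 then (80, [(a, Stay), (b, Move_Right)])
        else (nat (59 + (int (b - 1) + int s - 59) div 2),
              [(a, Stay), (nat ((int (b - 1) + int s - 59) mod 2) + 1, Move_Left)])
      else if s = 80 then
        if b \<noteq> 0 then (80, [(a, Stay), (b, Move_Right)])
        else if a \<noteq> 0 then (56, [(a, Move_Left), (b, Move_Left)])
        else (81, [(a, Stay), (b, Move_Left)])
      else if s = 81 then
        if b \<noteq> 0 then (81, [(a, Stay), (b, Move_Left)]) else (82, [(a, Stay), (b, Move_Right)])
      else if s = 82 \<and> b = 1 then (82, [(a, Stay), (b, Move_Right)])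
      else (83, [(a, Stay), (b, Stay)]))"

definition d_tm :: tm where
  "d_tm = \<lparr>num_tapes = 2, num_states = 84, num_symbols = 3, start = 0, halt = 83,
        trans = (\<lambda>s syms. table s (syms ! 0) (syms ! 1))\<rparr>"

lemma d_tm_simps [simp]:
  "num_tapes d_tm = 2" "num_states d_tm = 84" "num_symbols d_tm = 3" "start d_tm = 0" "halt d_tm = 83"
  "trans d_tm s syms = table s (syms ! 0) (syms ! 1)"
  by (simp_all add: d_tm_def)

lemma table_wf:
  assumes "s < 84" "a < 3" "b < 3" "table s a b = (s', acts)"
  shows "s' < 84 \<and> length acts = 2 \<and> fst ` set acts \<subseteq> {..<3}"
proof -
  consider "s < 56" "a = 0" | "s < 56" "a \<noteq> 0" | "56 \<le> s" "s < 80" | "80 \<le> s" by linarith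
  then show ?thesis
  proof cases
    case 1
    have "s div 28 \<le> 1" using 1 by linarith
    then have "60 + \<tau> (s mod 28) + 3 * int (s div 28) < 84"
      using \<tau>_bounds[of "s mod 28"] by simp
    then show ?thesis using 1 assms by (auto simp: table_def nat_less_iff)
  next
    case 2
    have "\<delta> (s mod 28) (a - 1) < 28" by (rule profile_step_profiles) simp
    then show ?thesis using 2 assms by (auto simp: table_def)
  next
    case 3
    have "(int (b - 1) + int s - 59) div 2 < 12" using 3 assms by linarith
    moreover have "nat ((int (b - 1) + int s - 59) mod 2) < 2" by linarith
    ultimately show ?thesis using 3 assms by (auto simp: table_def nat_less_iff split: if_splits)
  next
    case 4
    then show ?thesis using assms by (auto simp: table_def split: if_splits)
  qed
qed

lemma wf_d_tm: "wf_tm d_tm"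
proof -
  have "s' < 84 \<and> length acts = 2 \<and> fst ` set acts \<subseteq> {..<3}"
    if "s < 84" "length syms = 2" "set syms \<subseteq> {..<3}" "table s (syms ! 0) (syms ! 1) = (s', acts)"
    for s syms s' acts
  proof (rule table_wf)
    show "syms ! 0 < 3" "syms ! 1 < 3"
      using that(3) nth_mem[of 0 syms] nth_mem[of 1 syms] by (auto simp: that(2) subset_iff)
  qed (use that in auto)
  then show ?thesis by (auto simp: wf_tm_def)
qed

lemma step_d_tm:
  "s \<noteq> 83 \<Longrightarrow> step d_tm (s, [(t, h), (t', h')]) =
     (fst (table s (t h) (t' h')), map2 act (snd (table s (t h) (t' h'))) [(t, h), (t', h')])"
  by (simp add: split_def Let_def)

declare step.simps [simp del]

text \<open>The second tape carries the digits of \<open>xs\<close>, least significant digit first, leftwards from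
  position \<open>R - 1\<close>; its head is at distance \<open>j\<close> to the left of \<open>R\<close>.\<close>

definition tape_of :: "int \<Rightarrow> nat list \<Rightarrow> int \<Rightarrow> nat" where
  "tape_of R xs i = (if R - int (length xs) \<le> i \<and> i < R then xs ! nat (R - 1 - i) + 1 else 0)"

lemma tape_of_at:
  "tape_of R xs (R - int j) = (if 1 \<le> j \<and> j \<le> length xs then xs ! (j - 1) + 1 else 0)"
  by (auto simp: tape_of_def nat_diff_distrib' intro!: arg_cong[of _ _ "\<lambda>k. xs ! k"])

lemma tape_of_update:
  "(tape_of R (xs @ bs))(R - int (Suc (length xs)) := Suc b) = tape_of R (xs @ b # tl bs)"
proof
  fix i
  show "((tape_of R (xs @ bs))(R - int (Suc (length xs)) := Suc b)) i = tape_of R (xs @ b # tl bs) i"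
    by (cases bs) (auto simp: tape_of_def nth_append nth_Cons' nat_diff_distrib' nat_le_iff)
qed

section \<open>The arithmetic phases, during which the first tape \<open>u\<close> is only
  read\<close>

context
  fixes u :: "int \<Rightarrow> nat" and R :: int
begin

definition conf :: "nat \<Rightarrow> int \<Rightarrow> nat list \<Rightarrow> nat \<Rightarrow> nat \<times> tape list" where
  "conf s h xs j = (s, [(u, h), (tape_of R xs, R - int j)])"

text \<open>\<open>xs\<close> holds the digits already rewritten and \<open>bs\<close> those still
  to come. Each result digit costs one step, and one more detects the end. The bounds on
  \<open>c\<close> keep the state between 56 and 79.\<close>

lemma sweep:
  assumes "0 \<le> val bs + c" "-3 \<le> c" "c \<le> 20" "set bs \<subseteq> {..<2}"
  shows "steps d_tm (Suc (length (add_carry c bs)))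
    (conf (nat (59 + c)) h (xs @ bs) (Suc (length xs)))
    (conf 80 h (xs @ add_carry c bs) (length xs + length (add_carry c bs)))"
  using assms
proof (induction c bs arbitrary: xs rule: add_carry.induct)
  case (1 c)
  have b: "tape_of R (xs @ []) (R - int (Suc (length xs))) = 0"
    by (simp only: tape_of_at) simp
  show ?case
  proof (cases "c \<le> 0")
    case True
    then have "step d_tm (conf (nat (59 + c)) h (xs @ []) (Suc (length xs))) = conf 80 h xs (length xs)"
      using 1 b by (simp add: conf_def step_d_tm table_def fun_upd_idem)
    from steps_step[OF this] show ?thesis using True by (simp add: add_carry.simps)
  next
    case False
    \<comment> \<open>A blank counts as digit 0, because \<open>b - 1\<close> is 0 for
      \<open>b = 0\<close>.\<close>
    have "step d_tm (conf (nat (59 + c)) h (xs @ []) (Suc (length xs))) =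
        conf (nat (59 + c div 2)) h (xs @ [nat (c mod 2)]) (Suc (Suc (length xs)))"
      using 1 False b tape_of_update[of R xs "[]" "nat (c mod 2)"]
      by (auto simp: conf_def step_d_tm table_def nat_less_iff)
    from steps_Suc[OF this] show ?thesis
      using "1.IH"[of "xs @ [nat (c mod 2)]"] 1 False
      by (subst (1 2 3) add_carry.simps) auto
  qed
next
  case (2 c b bs)
  have b: "tape_of R (xs @ b # bs) (R - int (Suc (length xs))) = Suc b"
    by (simp only: tape_of_at) simp
  have "b < 2" using 2 by simp
  then have "step d_tm (conf (nat (59 + c)) h (xs @ b # bs) (Suc (length xs))) =
      conf (nat (59 + (int b + c) div 2)) h (xs @ nat ((int b + c) mod 2) # bs) (Suc (Suc (length xs)))"
    using 2 b tape_of_update[of R xs "b # bs" "nat ((int b + c) mod 2)"]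
    by (auto simp: conf_def step_d_tm table_def nat_less_iff)
  note step = steps_Suc[OF this]
  have "0 \<le> val bs + (int b + c) div 2" using 2(2) by simp
  moreover have "-3 \<le> (int b + c) div 2" "(int b + c) div 2 \<le> 20"
    using 2 \<open>b < 2\<close> by linarith+
  ultimately show ?case
    using step "2.IH"[of "xs @ [nat ((int b + c) mod 2)]"] 2 by simp
qed

lemma return_right: "j \<le> length xs \<Longrightarrow> steps d_tm j (conf 80 h xs j) (conf 80 h xs 0)"
proof (induction j)
  case (Suc j)
  have "tape_of R xs (R - int (Suc j)) \<noteq> 0"
    by (simp only: tape_of_at) (use Suc in simp)
  then have "step d_tm (conf 80 h xs (Suc j)) = conf 80 h xs j"
    by (simp add: conf_def step_d_tm table_def fun_upd_idem)
  from steps_Suc[OF this] show ?case using Suc by auto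
qed (simp add: steps_0)

lemma add_pass:
  assumes "0 \<le> val xs + c" "-3 \<le> c" "c \<le> 20" "set xs \<subseteq> {..<2}"
  shows "steps d_tm (Suc (2 * length (add_carry c xs)))
    (conf (nat (59 + c)) h xs 1) (conf 80 h (add_carry c xs) 0)"
  using steps_trans[OF sweep[OF assms, of h "[]"], of "length (add_carry c xs)"] return_right[OF order_refl, of "add_carry c xs" h]
  by (simp add: mult_2)

text \<open>The first head serves as the loop counter: \<open>k\<close> input digits remain, and the
  blank at -1 ends the loop. Subtracting never lengthens the list, so every round fits the same time
  bound.\<close>

lemma subtract_loop:
  assumes "\<And>i. i < k \<Longrightarrow> u (int i) \<noteq> 0" "u (-1) = 0"
    and "3 * int k \<le> val xs" "set xs \<subseteq> {..<2}"
  shows "\<exists>t ys. steps d_tm t (conf 80 (int k - 1) xs 0) (conf 81 (-1) ys 1) \<and>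
    t \<le> k * (2 * length xs + 2) + 1 \<and>
    val ys = val xs - 3 * int k \<and> set ys \<subseteq> {..<2} \<and> length ys \<le> length xs"
  using assms
proof (induction k arbitrary: xs)
  case 0
  have "tape_of R xs R = 0" using tape_of_at[of R xs 0] by simp
  then have "step d_tm (conf 80 (-1) xs 0) = conf 81 (-1) xs 1"
    using 0 by (simp add: conf_def step_d_tm table_def fun_upd_idem)
  from steps_step[OF this] show ?case using 0 by fastforce
next
  case (Suc k)
  let ?ys = "add_carry (-3) xs"
  have v: "val ?ys = val xs - 3" using Suc.prems by (subst val_add_carry) auto
  have l: "length ?ys \<le> length xs" using length_add_carry[of xs "-3"] Suc.prems by simp
  have "tape_of R xs R = 0" using tape_of_at[of R xs 0] by simp
  \<comment> \<open>State 56 is \<open>59 + c\<close> for \<open>c = -3\<close>, so the adding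
    states do the subtraction.\<close>
  then have "step d_tm (conf 80 (int (Suc k) - 1) xs 0) = conf (nat (59 + (-3))) (int k - 1) xs 1"
    using Suc.prems(1)[of k] by (simp add: conf_def step_d_tm table_def fun_upd_idem)
  moreover have "steps d_tm (Suc (2 * length ?ys)) (conf (nat (59 + (-3))) (int k - 1) xs 1) (conf 80 (int k - 1) ?ys 0)"
    using Suc.prems by (intro add_pass) auto
  ultimately have 1: "steps d_tm (Suc (Suc (2 * length ?ys))) (conf 80 (int (Suc k) - 1) xs 0) (conf 80 (int k - 1) ?ys 0)"
    by (rule steps_Suc)
  obtain t ys where t: "steps d_tm t (conf 80 (int k - 1) ?ys 0) (conf 81 (-1) ys 1)"
      "t \<le> k * (2 * length ?ys + 2) + 1"
      "val ys = val ?ys - 3 * int k" "set ys \<subseteq> {..<2}" "length ys \<le> length ?ys"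
    using Suc.IH[of ?ys] Suc.prems v add_carry_digits by auto
  have "k * (2 * length ?ys + 2) \<le> k * (2 * length xs + 2)" using l by (intro mult_le_mono) auto
  then have "Suc (Suc (2 * length ?ys)) + t \<le> Suc k * (2 * length xs + 2) + 1"
    using t(2) l unfolding mult_Suc by linarith
  then show ?case using steps_trans[OF 1 t(1)] t v l by fastforce
qed

text \<open>\<open>j\<close> counts the digits still to cross; at \<open>j = 0\<close> the head is
  on the blank left of the list.\<close>

lemma go_left:
  assumes "j \<le> length xs"
  shows "steps d_tm (Suc j) (conf 81 h xs (Suc (length xs) - j)) (conf 82 h xs (length xs))"
  using assms
proof (induction j)
  case 0
  have "tape_of R xs (R - int (Suc (length xs))) = 0"
    by (simp only: tape_of_at) simp
  then have "step d_tm (conf 81 h xs (Suc (length xs))) = conf 82 h xs (length xs)"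
    by (simp add: conf_def step_d_tm table_def fun_upd_idem)
  from steps_step[OF this] show ?case by simp
next
  case (Suc j)
  have "tape_of R xs (R - int (Suc (length xs) - Suc j)) \<noteq> 0"
    by (simp only: tape_of_at) (use Suc in auto)
  then have "step d_tm (conf 81 h xs (Suc (length xs) - Suc j)) = conf 81 h xs (Suc (length xs) - j)"
    using Suc.prems by (simp add: conf_def step_d_tm table_def fun_upd_idem of_nat_diff)
  from steps_Suc[OF this] show ?case using Suc by auto
qed

text \<open>\<open>k\<close> leading zeros are still to be crossed and \<open>m\<close> already
  were; the list stays fixed during the induction on \<open>k\<close> for varying
  \<open>m\<close>.\<close>

lemma skip_zeros:
  "steps d_tm (Suc k) (conf 82 h (ys @ [1] @ replicate (k + m) 0) (Suc (length ys + k)))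
     (conf 83 h (ys @ [1] @ replicate (k + m) 0) (Suc (length ys)))"
proof (induction k arbitrary: m)
  case 0
  have "tape_of R (ys @ [1] @ replicate m 0) (R - int (Suc (length ys))) = 2"
    by (simp only: tape_of_at) (simp add: nth_append)
  then have "step d_tm (conf 82 h (ys @ [1] @ replicate m 0) (Suc (length ys))) =
      conf 83 h (ys @ [1] @ replicate m 0) (Suc (length ys))"
    by (simp add: conf_def step_d_tm table_def fun_upd_idem)
  from steps_step[OF this] show ?case by simp
next
  case (Suc k)
  let ?xs = "ys @ [1] @ replicate (k + Suc m) 0"
  have "tape_of R ?xs (R - int (Suc (length ys + Suc k))) = 1"
    by (simp only: tape_of_at) (simp add: nth_append nth_Cons')
  then have "step d_tm (conf 82 h ?xs (Suc (length ys + Suc k))) = conf 82 h ?xs (Suc (length ys + k))"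
    by (simp add: conf_def step_d_tm table_def fun_upd_idem)
  from steps_Suc[OF this] show ?case using Suc[of "Suc m"] by simp
qed

text \<open>Zeros left of the head, in \<open>zs\<close>, may stay on the tape: the output is read
  rightwards, most significant digit first.\<close>

lemma has_word_tape_of:
  "has_word (tape_of R (ys @ zs), R - int (length ys)) (rev ys)"
proof -
  have "tape_of R (ys @ zs) (R - int (length ys) + int i) = rev ys ! i + 1" if "i < length ys" for i
  proof -
    have "R - int (length ys) + int i = R - int (length ys - i)" using that by simp
    then show ?thesis using that by (simp only: tape_of_at) (auto simp add: nth_append rev_nth)
  qed
  moreover have "tape_of R (ys @ zs) R = 0" using tape_of_at[of R _ 0] by simp
  ultimately show ?thesis by simp
qed

lemma finish:
  assumes "val xs > 0" "set xs \<subseteq> {..<2}"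
  shows "\<exists>t tps. steps d_tm t (conf 81 h xs 1) (83, tps) \<and> has_word (last tps) (bin (nat (val xs))) \<and>
    t \<le> 2 * length xs + 2"
proof -
  obtain ys k where xs: "xs = ys @ [1] @ replicate k 0" "set ys \<subseteq> {..<2}" "val xs = val (ys @ [1])"
    using strip_leading_zeros assms by metis
  have "steps d_tm (Suc (length xs)) (conf 81 h xs 1) (conf 82 h xs (length xs))"
    using go_left[of "length xs" xs h] by simp
  moreover have "steps d_tm (Suc k) (conf 82 h xs (length xs)) (conf 83 h xs (Suc (length ys)))"
    using skip_zeros[of k h ys 0] xs(1) by simp
  ultimately have "steps d_tm (Suc (length xs) + Suc k) (conf 81 h xs 1) (conf 83 h xs (Suc (length ys)))"
    by (rule steps_trans)
  moreover have "has_word (tape_of R xs, R - int (Suc (length ys))) (bin (nat (val xs)))"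
    using has_word_tape_of[of "ys @ [1]" "replicate k 0"] bin_val[OF xs(2)] xs(3) by (simp add: xs(1))
  ultimately show ?thesis
    unfolding conf_def using xs(1) by (intro exI conjI) auto
qed

end

section \<open>The copying phase and the complete run\<close>

lemma fst_word_tape_snoc:
  "(fst (word_tape w))(int (length w) := Suc b) = fst (word_tape (w @ [b]))"
  by (rule ext) (auto simp: word_tape_def nth_append)

lemma fst_word_tape_eq: "fst (word_tape w) = tape_of (int (length w)) (rev w)"
  by (rule ext) (auto simp: word_tape_def tape_of_def rev_nth nat_less_iff intro!: arg_cong[of _ _ "\<lambda>k. w ! k"])

lemma foldl_\<delta>_less: "foldl \<delta> 0 w < 28"
  by (induction w rule: rev_induct) (auto intro: profile_step_profiles)

lemma scan:
  assumes "set w \<subseteq> {..<2}" "j \<le> length w"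
  shows "steps d_tm j (0, [(fst (word_tape w), 0), (fst (word_tape []), 0)])
    (foldl \<delta> 0 (take j w) + 28 * of_bool (0 \<in> set (take j w)),
     [(fst (word_tape w), int j), (fst (word_tape (take j w)), int j)])"
  using assms(2)
proof (induction j)
  case (Suc j)
  let ?q = "foldl \<delta> 0 (take j w)" and ?z = "0 \<in> set (take j w)"
  have q: "?q < 28" by (rule foldl_\<delta>_less)
  have tk: "take (Suc j) w = take j w @ [w ! j]" using Suc.prems by (simp add: take_Suc_conv_app_nth)
  have "w ! j \<in> set w" using Suc.prems by simp
  then have wj: "w ! j = 0 \<or> w ! j = 1" using assms(1) by fastforce
  have r: "fst (word_tape w) (int j) = Suc (w ! j)"
    using Suc.prems by (simp add: word_tape_def)
  have up: "(fst (word_tape (take j w)))(int j := Suc (w ! j)) = fst (word_tape (take (Suc j) w))"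
    using fst_word_tape_snoc[of "take j w" "w ! j"] Suc.prems tk by simp
  have up': "(fst (word_tape w))(int j := Suc (w ! j)) = fst (word_tape w)"
    using r by (simp add: fun_upd_idem)
  have "step d_tm (?q + 28 * of_bool ?z, [(fst (word_tape w), int j), (fst (word_tape (take j w)), int j)]) =
    (foldl \<delta> 0 (take (Suc j) w) + 28 * of_bool (0 \<in> set (take (Suc j) w)),
     [(fst (word_tape w), int (Suc j)), (fst (word_tape (take (Suc j) w)), int (Suc j))])"
    using q wj by (subst step_d_tm) (auto simp: table_def r up up' tk)
  from steps_trans[OF Suc.IH steps_step[OF this]] show ?case using Suc.prems by simp
qed (simp add: steps_0)

lemma d_tm_computes_d:
  "\<exists>t. outputs_within d_tm n (nat (d n)) t \<and>
     t \<le> 2 * length (bin n) ^ 2 + 45 * length (bin n) + 81"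
proof -
  define w where "w = bin n"
  define l where "l = length w"
  define c where "c = 1 + e n + 3 * of_bool (0 \<in> set w)"
  let ?u = "fst (word_tape w)"
  let ?conf = "conf ?u (int l)"
  have w: "set w \<subseteq> {..<2}" by (simp add: w_def bin_digits)
  have d: "d n = int n + c - 3 * int l"
    unfolding d_formula floor_log2_Suc c_def l_def w_def by simp
  have q: "foldl \<delta> 0 w < 28" by (rule foldl_\<delta>_less)
  have e: "e n = \<tau> (foldl \<delta> 0 w)" by (simp add: e_def w_def)
  have c: "-3 \<le> c" "c \<le> 19" using \<tau>_bounds[OF q] by (auto simp: c_def e)
  have copy: "steps d_tm l (init_config d_tm n) (foldl \<delta> 0 w + 28 * of_bool (0 \<in> set w), [(?u, int l), (?u, int l)])"
    using scan[OF w, of l] by (simp add: l_def init_config_def w_def[symmetric] word_tape_def)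
  have turn: "step d_tm (foldl \<delta> 0 w + 28 * of_bool (0 \<in> set w), [(?u, int l), (?u, int l)]) =
      ?conf (nat (59 + c)) (int l - 1) (rev w) 1"
  proof -
    have "?u (int l) = 0" by (simp add: word_tape_def l_def)
    moreover have "?u = tape_of (int l) (rev w)" by (simp add: fst_word_tape_eq l_def)
    moreover have "60 + \<tau> (foldl \<delta> 0 w) + 3 * of_bool (0 \<in> set w) = 59 + c" by (simp add: c_def e)
    ultimately show ?thesis using q
      by (subst step_d_tm) (auto simp: table_def conf_def fun_upd_idem)
  qed
  have 1: "steps d_tm (l + 1) (init_config d_tm n) (?conf (nat (59 + c)) (int l - 1) (rev w) 1)"
    using steps_trans[OF copy steps_step[OF turn]] by simp
  let ?xs = "add_carry c (rev w)"
  have v: "val (rev w) = int n" by (simp add: w_def val_rev_bin)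
  \<comment> \<open>The sum equals \<open>d n + 3 * int l\<close>; positivity of \<open>d n\<close>
    also keeps every later subtraction nonnegative.\<close>
  have nc: "0 \<le> int n + c" using d d_pos[of n] by linarith
  have 2: "steps d_tm (Suc (2 * length ?xs)) (?conf (nat (59 + c)) (int l - 1) (rev w) 1) (?conf 80 (int l - 1) ?xs 0)"
    using c w nc v by (intro add_pass) auto
  have v': "val ?xs = int n + c" using nc v by (simp add: val_add_carry)
  have len: "length ?xs \<le> l + 19" using length_add_carry[of "rev w" c] w c by (simp add: l_def)
  have "\<exists>t ys. steps d_tm t (?conf 80 (int l - 1) ?xs 0) (?conf 81 (-1) ys 1) \<and>
    t \<le> l * (2 * length ?xs + 2) + 1 \<and>
    val ys = val ?xs - 3 * int l \<and> set ys \<subseteq> {..<2} \<and> length ys \<le> length ?xs"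
    using v' d d_pos[of n] add_carry_digits
    by (intro subtract_loop) (auto simp: word_tape_def l_def)
  then obtain t ys where 3: "steps d_tm t (?conf 80 (int l - 1) ?xs 0) (?conf 81 (-1) ys 1)"
    and t: "t \<le> l * (2 * length ?xs + 2) + 1"
    and ys: "val ys = d n" "set ys \<subseteq> {..<2}" "length ys \<le> length ?xs"
    using v' d by auto
  obtain t' tps where 4: "steps d_tm t' (?conf 81 (-1) ys 1) (83, tps)"
    and tps: "has_word (last tps) (bin (nat (d n)))" and t': "t' \<le> 2 * length ys + 2"
    using finish[of ys ?u "int l" "-1"] ys d_pos[of n] by auto
  let ?t = "l + 1 + Suc (2 * length ?xs) + t + t'"
  have "steps d_tm ?t (init_config d_tm n) (83, tps)"
    by (rule steps_trans[OF steps_trans[OF steps_trans[OF 1 2] 3] 4])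
  then have "outputs_within d_tm n (nat (d n)) ?t"
    using tps by (auto simp: outputs_within_def steps_def)
  moreover have "l * (2 * length ?xs + 2) \<le> l * (2 * (l + 19) + 2)"
    using len by (intro mult_le_mono) auto
  \<comment> \<open>Both \<open>length ?xs\<close> and \<open>length ys\<close> are replaced by
    \<open>l + 19\<close>.\<close>
  then have "?t \<le> 2 * l ^ 2 + 45 * l + 81"
    using t t' ys(3) len by (simp add: power2_eq_square algebra_simps)
  ultimately show ?thesis unfolding l_def w_def by blast
qed

lemma computable_d: "computable_in_poly_log_time (\<lambda>n. nat (d n))"
  unfolding computable_in_poly_log_time_def
\<comment> \<open>The polynomial is \<open>2 * l ^ 2 + 45 * l + 81\<close> with \<open>x + 1\<close>
  for \<open>l\<close>, where \<open>x\<close> is the logarithm.\<close>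
proof (intro exI[of _ d_tm] exI[of _ "[:128, 49, 2:]"] conjI allI)
  show "wf_tm d_tm" by (rule wf_d_tm)
  fix n
  let ?l = "length (bin n)"
  obtain t where t: "outputs_within d_tm n (nat (d n)) t" "t \<le> 2 * ?l ^ 2 + 45 * ?l + 81"
    using d_tm_computes_d by blast
  have "real t \<le> poly [:128, 49, 2:] (log 2 (real n))" if "n \<ge> 1"
  proof -
    let ?x = "log 2 (real n)"
    have l: "real ?l \<le> ?x + 1" using that by (rule length_bin_le_log)
    have "real t \<le> real (2 * ?l ^ 2 + 45 * ?l + 81)" using t(2) by (rule of_nat_mono)
    also have "\<dots> = 2 * real ?l ^ 2 + 45 * real ?l + 81" by simp
    also have "\<dots> \<le> 2 * (?x + 1) ^ 2 + 45 * (?x + 1) + 81"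
      using l by (intro add_mono mult_left_mono power_mono) auto
    also have "\<dots> = poly [:128, 49, 2:] ?x" by (simp add: power2_eq_square algebra_simps)
    finally show ?thesis .
  qed
  with t(1) show "\<exists>t. outputs_within d_tm n (nat (d n)) t \<and>
      (n \<ge> 1 \<longrightarrow> real t \<le> poly [:128, 49, 2:] (log 2 (real n)))" by blast
qed

theorem theorem2:
  shows "(\<forall>n::nat. r3 A (int n) > r3 A (int n - 1)) \<and>
         computable_in_poly_log_time (\<lambda>n. nat (d n)) \<and>
         (\<forall>n::nat. d n = int n + 1 - 3 * \<lfloor>log 2 (real (n + 1))\<rfloor> + e n)"
proof (intro conjI allI)
  fix n :: nat
  show "r3 A (int n) > r3 A (int n - 1)"
    using d_pos[of n] by (simp add: d_def)
qed (rule computable_d d_formula)+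

end
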